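(* Let $n\ge 1$ and let $(x_1,y_1),\dots,(x_n,y_n)$ be data points with $x_i,y_i>0$ for all $i$, and such that for all $i\neq j$, $(x_i,y_i)\neq(x_j,y_j)$ and $(x_i,y_i)\neq(y_j,x_j)$. Put $g_i(\theta)=x_iy_i\theta^2+(x_i+y_i-1)\theta+1$. If every pair $g_i,g_j$ with $i\neq j$ has a common complex zero and one of the $g_i$ has a double zero, then the ML-degree of the association parameter $\theta$ in GBED($\theta$) for these data is $n$.
   Context: GBED($\theta$) is Gumbel's Type-I bivariate exponential distribution with association parameter $\theta\in[0,1]$, with density $e^{-(x+y+\theta xy)}[(1+\theta x)(1+\theta y)-\theta]$ on the first quadrant. For data $(x_i,y_i)$, $i=1,\dots,n$, put $c_i=x_iy_i$, $d_i=x_i+y_i-1$, $$f_i(\theta)=c_i^2\theta^2+c_i(d_i-2)\theta+(c_i-d_i),\qquad g_i(\theta)=c_i\theta^2+d_i\theta+1,$$ $$f(\theta)=\sum_{i=1}^n f_i(\theta)\prod_{j\neq i}g_j(\theta),\qquad g(\theta)=\prod_{i=1}^n g_i(\theta).$$ The score equation is $\sum_{i=1}^n f_i(\theta)/g_i(\theta)=0$, i.e. $f(\theta)/g(\theta)=0$. The ML-degree of $\theta$ for the given data is the number of solutions of the score equation over $\mathbb{C}$ counted with multiplicity, that is, the number of complex zeros of $f$ that are not zeros of $g$, each counted with its multiplicity as a zero of $f$. *)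

theory Defs
  imports Complex_Main "HOL-Computational_Algebra.Polynomial"
begin

definition gbed_c :: "real \<Rightarrow> real \<Rightarrow> real" where
  "gbed_c x y = x * y"

definition gbed_d :: "real \<Rightarrow> real \<Rightarrow> real" where
  "gbed_d x y = x + y - 1"

text \<open>
  The density of GBED(\<open>\<theta>\<close>) at \<open>(x, y)\<close> is \<open>exp (-(x + y + \<theta> * x * y)) * g \<theta>\<close> with
  \<open>g \<theta> = c * \<theta>^2 + d * \<theta> + 1\<close>, so its score is \<open>g' / g - c = - f / g\<close> with
  \<open>f = c * g - g'\<close>. Both \<open>f\<close> and \<open>g\<close> are polynomials in the parameter \<open>\<theta>\<close>, taken over the
  complex numbers; coefficients are listed from the constant term upwards.
\<close>

definition gbed_g :: "real \<Rightarrow> real \<Rightarrow> complex poly" where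
  "gbed_g x y = [: 1, of_real (gbed_d x y), of_real (gbed_c x y) :]"

definition gbed_f :: "real \<Rightarrow> real \<Rightarrow> complex poly" where
  "gbed_f x y = [: of_real (gbed_c x y - gbed_d x y),
                   of_real (gbed_c x y * (gbed_d x y - 2)),
                   of_real ((gbed_c x y)\<^sup>2) :]"

lemma poly_gbed_g:
  "poly (gbed_g x y) \<theta> = of_real (x * y) * \<theta>\<^sup>2 + of_real (x + y - 1) * \<theta> + 1"
  by (simp add: gbed_g_def gbed_c_def gbed_d_def algebra_simps power2_eq_square)

lemma poly_gbed_f:
  "poly (gbed_f x y) \<theta> =
     of_real ((gbed_c x y)\<^sup>2) * \<theta>\<^sup>2 + of_real (gbed_c x y * (gbed_d x y - 2)) * \<theta>
     + of_real (gbed_c x y - gbed_d x y)"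
  by (simp add: gbed_f_def algebra_simps power2_eq_square)

definition gbed_score_num :: "nat \<Rightarrow> (nat \<Rightarrow> real) \<Rightarrow> (nat \<Rightarrow> real) \<Rightarrow> complex poly" where
  "gbed_score_num n x y =
     (\<Sum>i\<in>{1..n}. gbed_f (x i) (y i) * (\<Prod>j\<in>{1..n} - {i}. gbed_g (x j) (y j)))"

definition gbed_score_den :: "nat \<Rightarrow> (nat \<Rightarrow> real) \<Rightarrow> (nat \<Rightarrow> real) \<Rightarrow> complex poly" where
  "gbed_score_den n x y = (\<Prod>i\<in>{1..n}. gbed_g (x i) (y i))"

text \<open>
  For \<open>n \<ge> 1\<close> and positive data the numerator is a nonzero polynomial (its coefficient of
  \<open>\<theta>^(2 * n)\<close> is \<open>(\<Sum>i. c\<^sub>i) * (\<Prod>i. c\<^sub>i)\<close>), so that the sum below is over a finite set and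
  \<open>order\<close> is the multiplicity of a zero.
\<close>

definition gbed_ML_degree :: "nat \<Rightarrow> (nat \<Rightarrow> real) \<Rightarrow> (nat \<Rightarrow> real) \<Rightarrow> nat" where
  "gbed_ML_degree n x y =
     (\<Sum>\<theta> | poly (gbed_score_num n x y) \<theta> = 0 \<and> poly (gbed_score_den n x y) \<theta> \<noteq> 0.
        order \<theta> (gbed_score_num n x y))"

end

theory Submission
  imports Defs "HOL-Computational_Algebra.Fundamental_Theorem_Algebra"
begin

text \<open>
  Each \<open>f\<^sub>i\<close> equals \<open>c\<^sub>i * g\<^sub>i - g\<^sub>i'\<close>, so the product rule turns the numerator of the score into
  \<open>f = C * g - g'\<close> with \<open>C = \<Sum>i. c\<^sub>i > 0\<close>. Hence \<open>f\<close> has the degree of \<open>g\<close>, and a zero of \<open>g\<close> of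
  multiplicity \<open>m\<close> is a zero of \<open>f\<close> of multiplicity exactly \<open>m - 1\<close>. Over the complex numbers the
  multiplicities of either polynomial add up to the common degree, so the zeros of \<open>f\<close> that are
  not zeros of \<open>g\<close> number as many as the distinct zeros of \<open>g\<close>: for all positive data, the ML-degree
  is the number of distinct zeros of \<open>g\<close> (\<open>gbed_ML_degree_eq_card_zeros\<close>).

  It remains to count these. If \<open>r\<close> is the double zero of \<open>g\<^sub>k\<close>, it is the only zero of \<open>g\<^sub>k\<close>, so
  every \<open>g\<^sub>i\<close> vanishes at \<open>r\<close>. As the constant term of \<open>g\<^sub>i\<close> is \<open>1\<close>, its other zero is
  \<open>s\<^sub>i = 1 / (c\<^sub>i * r)\<close>, and \<open>s\<^sub>k = r\<close>; thus the zeros of \<open>g\<close> are exactly the \<open>s\<^sub>i\<close>.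
  They are pairwise distinct, because \<open>r\<close> and \<open>s\<^sub>i\<close> determine \<open>c\<^sub>i\<close> and \<open>d\<^sub>i\<close>, hence the product
  and the sum of \<open>x\<^sub>i\<close> and \<open>y\<^sub>i\<close>, and so the data point up to swapping its coordinates.
\<close>

text \<open>
  The term \<open>smult C p\<close> vanishes at \<open>x\<close> to a higher order than \<open>pderiv p\<close> does, so it cannot affect
  the order of the difference.
\<close>

lemma order_smult_minus_pderiv:
  fixes p :: "'a :: {idom, semiring_char_0} poly"
  assumes "p \<noteq> 0" and "poly p x = 0"
  shows "order x p = Suc (order x (smult C p - pderiv p))"
proof -
  define q where "q = smult C p - pderiv p"
  define m where "m = order x (pderiv p)"
  have ord_p: "order x p = Suc m"
    using order_pderiv[OF assms(1,2)] by (simp add: m_def)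
  have p_dvd: "[:-x, 1:] ^ Suc m dvd p"
    using order_1[of x p] by (simp add: ord_p)
  then have Cp_dvd: "[:-x, 1:] ^ Suc m dvd smult C p"
    by (rule dvd_smult)
  have "pderiv p \<noteq> 0"
  proof
    assume "pderiv p = 0"
    then obtain h where "p = [:h:]"
      using pderiv_iszero by blast
    with assms(1,2) show False by simp
  qed
  then have not_dvd: "\<not> [:-x, 1:] ^ Suc m dvd pderiv p"
    using order_2 unfolding m_def by blast
  have "[:-x, 1:] ^ m dvd q"
    unfolding q_def using Cp_dvd order_1[of x "pderiv p"]
    by (intro dvd_diff) (auto simp: m_def intro: power_le_dvd[OF Cp_dvd])
  moreover have "\<not> [:-x, 1:] ^ Suc m dvd q"
  proof
    assume "[:-x, 1:] ^ Suc m dvd q"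
    with Cp_dvd have "[:-x, 1:] ^ Suc m dvd smult C p - q"
      by (rule dvd_diff)
    with not_dvd show False by (simp add: q_def)
  qed
  ultimately have "order x q = m"
    by (rule order_unique_lemma)
  with ord_p show ?thesis by (simp add: q_def)
qed

lemma degree_smult_minus_pderiv:
  fixes p :: "'a :: {idom, semiring_char_0} poly"
  assumes "C \<noteq> 0"
  shows "degree (smult C p - pderiv p) = degree p"
proof (cases "degree p = 0")
  case True
  then show ?thesis
    using assms by (metis degree_smult_eq diff_zero pderiv_eq_0_iff)
next
  case False
  then have "degree (- pderiv p) < degree (smult C p)"
    using assms by (simp add: degree_pderiv)
  then show ?thesis
    using assms degree_add_eq_left[of "- pderiv p" "smult C p"] by simp
qed

lemma sum_order_complex:
  fixes p :: "complex poly"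
  assumes "p \<noteq> 0"
  shows "(\<Sum>z | poly p z = 0. order z p) = degree p"
  using size_proots_complex[of p] assms
  by (simp add: size_multiset_overloaded_eq)

text \<open>
  The degree count behind the ML-degree formula: \<open>p\<close> and \<open>smult C p - pderiv p\<close> have equally many
  zeros with multiplicity, and at each distinct zero of \<open>p\<close> the second polynomial loses one. This
  loss is made up by zeros elsewhere.
\<close>

lemma sum_order_smult_minus_pderiv:
  fixes p :: "complex poly"
  assumes "p \<noteq> 0" and "C \<noteq> 0"
  defines "q \<equiv> smult C p - pderiv p"
  shows "(\<Sum>z | poly q z = 0 \<and> poly p z \<noteq> 0. order z q) = card {z. poly p z = 0}"
proof -
  define A where "A = {z. poly p z = 0}"
  define B where "B = {z. poly q z = 0 \<and> poly p z \<noteq> 0}"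
  have deg: "degree q = degree p"
    unfolding q_def by (rule degree_smult_minus_pderiv[OF assms(2)])
  have "q \<noteq> 0"
  proof
    assume "q = 0"
    with deg have "degree p = 0" by simp
    then have "pderiv p = 0" by (simp add: pderiv_eq_0_iff)
    with \<open>q = 0\<close> assms(1,2) show False by (simp add: q_def)
  qed
  then have fin: "finite A" "finite B"
    using poly_roots_finite[OF assms(1)] poly_roots_finite[of q]
    by (auto simp: A_def B_def intro: finite_subset)
  have "degree p = (\<Sum>z\<in>A. order z p)"
    using sum_order_complex[OF assms(1)] by (simp add: A_def)
  also have "\<dots> = (\<Sum>z\<in>A. Suc (order z q))"
    using assms(1) unfolding q_def
    by (intro sum.cong) (auto simp: A_def intro: order_smult_minus_pderiv)
  also have "\<dots> = card A + (\<Sum>z\<in>A. order z q)"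
    by (simp add: sum_Suc)
  finally have sum_A: "degree p = card A + (\<Sum>z\<in>A. order z q)" .
  have "degree p = (\<Sum>z | poly q z = 0. order z q)"
    using sum_order_complex[OF \<open>q \<noteq> 0\<close>] deg by simp
  \<comment> \<open>simple zeros of \<open>p\<close> lie in \<open>A\<close> without being zeros of \<open>q\<close>; they contribute order \<open>0\<close>\<close>
  also have "\<dots> = (\<Sum>z\<in>A \<union> B. order z q)"
    using fin by (intro sum.mono_neutral_left) (auto simp: A_def B_def order_0I)
  also have "\<dots> = (\<Sum>z\<in>A. order z q) + (\<Sum>z\<in>B. order z q)"
    using fin by (intro sum.union_disjoint) (auto simp: A_def B_def)
  finally show ?thesis
    using sum_A by (simp add: A_def B_def)
qed

lemma gbed_f_eq:
  "gbed_f x y = smult (of_real (gbed_c x y)) (gbed_g x y) - pderiv (gbed_g x y)"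
  by (simp add: gbed_f_def gbed_g_def pderiv_pCons algebra_simps power2_eq_square)

lemma gbed_score_num_eq:
  "gbed_score_num n x y =
     smult (of_real (\<Sum>i\<in>{1..n}. gbed_c (x i) (y i))) (gbed_score_den n x y)
     - pderiv (gbed_score_den n x y)"
proof -
  let ?G = "\<lambda>i. gbed_g (x i) (y i)" and ?c = "\<lambda>i. complex_of_real (gbed_c (x i) (y i))"
  have "gbed_score_num n x y =
      (\<Sum>i\<in>{1..n}. smult (?c i) (?G i * (\<Prod>j\<in>{1..n} - {i}. ?G j))
                    - (\<Prod>j\<in>{1..n} - {i}. ?G j) * pderiv (?G i))"
    by (simp add: gbed_score_num_def gbed_f_eq algebra_simps)
  also have "\<dots> = (\<Sum>i\<in>{1..n}. smult (?c i) (gbed_score_den n x y)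
                    - (\<Prod>j\<in>{1..n} - {i}. ?G j) * pderiv (?G i))"
    by (intro sum.cong) (simp_all add: gbed_score_den_def prod.remove)
  also have "\<dots> = smult (\<Sum>i\<in>{1..n}. ?c i) (gbed_score_den n x y) - pderiv (gbed_score_den n x y)"
    by (simp add: sum_subtractf smult_sum gbed_score_den_def pderiv_prod)
  finally show ?thesis by simp
qed

theorem gbed_ML_degree_eq_card_zeros:
  assumes "n \<ge> 1" and pos: "\<And>i. i \<in> {1..n} \<Longrightarrow> x i > 0 \<and> y i > 0"
  shows "gbed_ML_degree n x y = card {z. poly (gbed_score_den n x y) z = 0}"
proof -
  have "gbed_score_den n x y \<noteq> 0"
    by (auto simp: gbed_score_den_def gbed_g_def)
  moreover have "(\<Sum>i\<in>{1..n}. gbed_c (x i) (y i)) > 0"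
    using assms by (intro sum_pos) (auto simp: gbed_c_def)
  then have "complex_of_real (\<Sum>i\<in>{1..n}. gbed_c (x i) (y i)) \<noteq> 0"
    using of_real_eq_0_iff less_irrefl by metis
  ultimately show ?thesis
    unfolding gbed_ML_degree_def gbed_score_num_eq
    by (rule sum_order_smult_minus_pderiv)
qed

text \<open>
  Vieta's formulas: the constant term of \<open>gbed_g x y\<close> is \<open>1\<close>, so its zeros multiply to \<open>1 / c\<close>
  and \<open>r\<close> leaves only one free coefficient.
\<close>

lemma gbed_g_zeros:
  assumes "gbed_c x y \<noteq> 0" and "poly (gbed_g x y) r = 0"
  shows "poly (gbed_g x y) z = 0 \<longleftrightarrow> z = r \<or> z = 1 / (of_real (gbed_c x y) * r)"
    and "of_real (gbed_d x y) = - of_real (gbed_c x y) * r - 1 / r"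
proof -
  define c d where "c = complex_of_real (gbed_c x y)" and "d = complex_of_real (gbed_d x y)"
  have "c \<noteq> 0" using assms(1) by (simp add: c_def)
  have root: "1 + r * (d + r * c) = 0"
    using assms(2) by (simp add: gbed_g_def c_def d_def)
  then have "r \<noteq> 0" by auto
  have d: "d = - c * r - 1 / r"
  proof -
    have "r * (1 / r) = 1" using \<open>r \<noteq> 0\<close> by simp
    with root show ?thesis by algebra
  qed
  then show "of_real (gbed_d x y) = - of_real (gbed_c x y) * r - 1 / r"
    by (simp add: c_def d_def)
  have "poly (gbed_g x y) z = 1 + z * (d + z * c)"
    by (simp add: gbed_g_def c_def d_def)
  also have "\<dots> = c * (z - r) * (z - 1 / (c * r))"
  proof -
    have "r * (1 / r) = 1" and "c * r * (1 / (c * r)) = 1"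
      using \<open>c \<noteq> 0\<close> \<open>r \<noteq> 0\<close> by simp_all
    with d show ?thesis by algebra
  qed
  finally show "poly (gbed_g x y) z = 0 \<longleftrightarrow> z = r \<or> z = 1 / (of_real (gbed_c x y) * r)"
    using \<open>c \<noteq> 0\<close> by (simp add: c_def)
qed

lemma gbed_g_double_zero:
  assumes "order r (gbed_g x y) = 2"
  shows "poly (gbed_g x y) r = 0" and "1 / (of_real (gbed_c x y) * r) = r"
proof -
  have nz: "gbed_g x y \<noteq> 0" by (simp add: gbed_g_def)
  show root: "poly (gbed_g x y) r = 0"
    using assms by (simp add: order_root)
  have "order r (pderiv (gbed_g x y)) = 1"
    using order_pderiv[OF nz root] assms by simp
  then have root': "poly (pderiv (gbed_g x y)) r = 0"
    by (simp add: order_root)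
  \<comment> \<open>eliminating \<open>d\<close> from \<open>g r = 0\<close> and \<open>g' r = 0\<close>\<close>
  have cr: "of_real (gbed_c x y) * r * r = 1"
    using root root' by (simp add: gbed_g_def pderiv_pCons) algebra
  then have "of_real (gbed_c x y) * r \<noteq> 0" by auto
  with cr show "1 / (of_real (gbed_c x y) * r) = r"
    by (simp add: divide_eq_eq mult.commute)
qed

lemma gbed_c_d_inject:
  assumes "gbed_c x y = gbed_c x' y'" and "gbed_d x y = gbed_d x' y'"
  shows "(x, y) = (x', y') \<or> (x, y) = (y', x')"
proof -
  have sum: "x + y = x' + y'" and "x * y = x' * y'"
    using assms by (simp_all add: gbed_c_def gbed_d_def)
  then have "(x - x') * (x - y') = 0" by algebra
  with sum show ?thesis by auto
qed

theorem theorem5p2: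
  fixes n :: nat and x y :: "nat \<Rightarrow> real"
  assumes "n \<ge> 1"
    and "\<And>i. i \<in> {1..n} \<Longrightarrow> x i > 0 \<and> y i > 0"
    and "\<And>i j. i \<in> {1..n} \<Longrightarrow> j \<in> {1..n} \<Longrightarrow> i \<noteq> j \<Longrightarrow>
           (x i, y i) \<noteq> (x j, y j) \<and> (x i, y i) \<noteq> (y j, x j)"
    and "\<And>i j. i \<in> {1..n} \<Longrightarrow> j \<in> {1..n} \<Longrightarrow> i \<noteq> j \<Longrightarrow>
           \<exists>z. poly (gbed_g (x i) (y i)) z = 0 \<and> poly (gbed_g (x j) (y j)) z = 0"
    and "\<exists>i\<in>{1..n}. \<exists>z. order z (gbed_g (x i) (y i)) = 2"
  shows "gbed_ML_degree n x y = n"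
proof -
  define c where "c i = gbed_c (x i) (y i)" for i
  have c_nz: "c i \<noteq> 0" if "i \<in> {1..n}" for i
    using assms(2)[OF that] by (simp add: c_def gbed_c_def)
  obtain k r where k: "k \<in> {1..n}" and dbl: "order r (gbed_g (x k) (y k)) = 2"
    using assms(5) by blast
  define s where "s i = 1 / (of_real (c i) * r)" for i
  note k_root = gbed_g_double_zero(1)[OF dbl]
  have s_k: "s k = r"
    using gbed_g_double_zero(2)[OF dbl] by (simp add: s_def c_def)
  have only_r: "z = r" if "poly (gbed_g (x k) (y k)) z = 0" for z
    using gbed_g_zeros(1)[OF c_nz[OF k, unfolded c_def] k_root] that s_k
    by (auto simp: s_def c_def)
  have common: "poly (gbed_g (x i) (y i)) r = 0" if "i \<in> {1..n}" for i
    using assms(4)[OF that k] only_r k_root by (cases "i = k") blast+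
  have zeros: "poly (gbed_g (x i) (y i)) z = 0 \<longleftrightarrow> z = r \<or> z = s i" if "i \<in> {1..n}" for i z
    using gbed_g_zeros(1)[OF c_nz[OF that, unfolded c_def] common[OF that]]
    by (simp add: s_def c_def)
  have "r \<noteq> 0"
    using k_root by (auto simp: gbed_g_def)
  have "inj_on s {1..n}"
  proof (rule inj_onI, rule ccontr)
    fix i j
    assume i: "i \<in> {1..n}" and j: "j \<in> {1..n}" and "s i = s j" and "i \<noteq> j"
    have c_eq: "c i = c j"
      using \<open>s i = s j\<close> \<open>r \<noteq> 0\<close> c_nz[OF i] c_nz[OF j] by (simp add: s_def)
    have "complex_of_real (gbed_d (x i) (y i)) = complex_of_real (gbed_d (x j) (y j))"
      using gbed_g_zeros(2)[OF c_nz[OF i, unfolded c_def] common[OF i]]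
            gbed_g_zeros(2)[OF c_nz[OF j, unfolded c_def] common[OF j]] c_eq
      by (simp add: c_def)
    with c_eq show False
      using gbed_c_d_inject[of "x i" "y i" "x j" "y j"] assms(3)[OF i j \<open>i \<noteq> j\<close>]
      by (auto simp: c_def)
  qed
  moreover have "{z. poly (gbed_score_den n x y) z = 0} = s ` {1..n}"
    using zeros k s_k by (auto simp: gbed_score_den_def poly_prod)
  ultimately have "card {z. poly (gbed_score_den n x y) z = 0} = n"
    by (simp add: card_image)
  with gbed_ML_degree_eq_card_zeros[OF assms(1,2)] show ?thesis by simp
qed

end
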